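(* Let $G$ be a finite soluble group, let $g\in G$, and let $n$ be a positive integer. Let $E_n(g)=\langle [x,\underbrace{g,\dots,g}_{n}] \mid x\in G\rangle$. If the Fitting height of $E_n(g)$ is equal to $k$, then $g\in F_{k+1}(G)$.
   Context: Commutators are left-normed: $[a_1,a_2,\dots,a_r]=[\dots[[a_1,a_2],a_3],\dots,a_r]$, with $[a,b]=a^{-1}b^{-1}ab$. $E_n(g)$ is the subgroup of $G$ generated by all commutators $[x,g,\dots,g]$ ($g$ repeated $n$ times) with $x$ ranging over $G$. For a finite group $G$, $F(G)$ is the Fitting subgroup (the largest normal nilpotent subgroup); the Fitting series is $F_0(G)=1$, and $F_{i+1}(G)$ is the full inverse image in $G$ of $F(G/F_i(G))$. The Fitting height of a finite soluble group $H$ is the least $h\ge 0$ such that $F_h(H)=H$. *)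

theory Defs
  imports "HOL-Algebra.Algebra"
begin

(* The convention [a, b] = a^-1 b^-1 a b differs from the one in the library's derived_set,
   which uses a b a^-1 b^-1. *)
definition commutator :: "('a, 'b) monoid_scheme \<Rightarrow> 'a \<Rightarrow> 'a \<Rightarrow> 'a" where
  "commutator G a b = inv\<^bsub>G\<^esub> a \<otimes>\<^bsub>G\<^esub> inv\<^bsub>G\<^esub> b \<otimes>\<^bsub>G\<^esub> a \<otimes>\<^bsub>G\<^esub> b"

(* left_normed_commutator G a1 [a2, ..., ar] is [...[[a1, a2], a3], ..., ar]. *)
definition left_normed_commutator :: "('a, 'b) monoid_scheme \<Rightarrow> 'a \<Rightarrow> 'a list \<Rightarrow> 'a" where
  "left_normed_commutator G a as = foldl (commutator G) a as"

definition engel_subgroup :: "('a, 'b) monoid_scheme \<Rightarrow> nat \<Rightarrow> 'a \<Rightarrow> 'a set" where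
  "engel_subgroup G n g =
     generate G {left_normed_commutator G x (replicate n g) | x. x \<in> carrier G}"

(* Indexed from 0: lower_central G i is the term usually written gamma_(i+1)(G). *)
primrec lower_central :: "('a, 'b) monoid_scheme \<Rightarrow> nat \<Rightarrow> 'a set" where
  "lower_central G 0 = carrier G"
| "lower_central G (Suc i) =
     generate G {commutator G a b | a b. a \<in> lower_central G i \<and> b \<in> carrier G}"

definition nilpotent_group :: "('a, 'b) monoid_scheme \<Rightarrow> bool" where
  "nilpotent_group G \<longleftrightarrow> group G \<and> (\<exists>c. lower_central G c = {\<one>\<^bsub>G\<^esub>})"

(* GREATEST is with respect to inclusion of carriers; it is meaningful for finite groups, where
   a largest normal nilpotent subgroup exists by Fitting's theorem. *)
definition fitting_subgroup :: "('a, 'b) monoid_scheme \<Rightarrow> 'a set" where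
  "fitting_subgroup G = (GREATEST N. N \<lhd> G \<and> nilpotent_group (G\<lparr>carrier := N\<rparr>))"

primrec fitting_series :: "('a, 'b) monoid_scheme \<Rightarrow> nat \<Rightarrow> 'a set" where
  "fitting_series G 0 = {\<one>\<^bsub>G\<^esub>}"
| "fitting_series G (Suc i) =
     {x \<in> carrier G. fitting_series G i #>\<^bsub>G\<^esub> x \<in> fitting_subgroup (G Mod fitting_series G i)}"

(* Meaningful for finite soluble groups, whose Fitting series reaches the whole group. *)
definition fitting_height :: "('a, 'b) monoid_scheme \<Rightarrow> nat" where
  "fitting_height H = (LEAST h. fitting_series H h = carrier H)"

end

theory Submission
  imports Defs
begin

text \<open>
  Suppose first that \<open>G\<close> is generated by the conjugates of \<open>g\<close>. Then \<open>E = E\<^sub>n(g)\<close> contains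
  \<open>[G, g]\<close>. Going down a chief series of \<open>G\<close>, let \<open>V < W\<close> be consecutive terms with
  \<open>[G, g] \<le> EW\<close>; we may work modulo \<open>V\<close>. As \<open>W\<close> is abelian, \<open>E \<inter> W\<close> is normal in \<open>G\<close>. If it is
  \<open>W\<close>, then \<open>[G, g] \<le> E\<close>. Otherwise it is trivial, so \<open>g\<close> acts on \<open>W\<close> as an Engel element and
  \<open>C\<^sub>W(g)\<close> is nontrivial. The key observation is that \<open>C\<^sub>G(g)\<close> normalises \<open>E\<close>; hence \<open>C\<^sub>W(g)\<close> commutes
  with \<open>E\<close>, \<open>W\<close> and \<open>g\<close>, so it is central, \<open>W\<close> is central, \<open>E\<close> is normal, and \<open>G/E\<close> is
  abelian. So again \<open>[G, g] \<le> E\<close>. Since \<open>G/[G, g]\<close> is abelian, the Fitting height of \<open>G\<close> is at most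
  one more than that of \<open>E\<close>.

  In general, replace \<open>G\<close> by the normal closure \<open>H\<close> of \<open>g\<close> and use induction on the order:
  \<open>E\<^sub>n(g)\<close> formed in \<open>H\<close> lies in \<open>E\<^sub>n(g)\<close> formed in \<open>G\<close>, and \<open>F\<^sub>i(H) \<le> F\<^sub>i(G)\<close>.
\<close>

section \<open>Commutators\<close>

context group
begin

lemma mult_inv_cancel_left:
  assumes "x \<in> carrier G" "y \<in> carrier G"
  shows "x \<otimes> (inv x \<otimes> y) = y" and "inv x \<otimes> (x \<otimes> y) = y"
  using assms by (simp_all flip: m_assoc)

lemma commutator_closed [simp, intro]:
  "x \<in> carrier G \<Longrightarrow> y \<in> carrier G \<Longrightarrow> commutator G x y \<in> carrier G"
  by (simp add: commutator_def)

lemma commutator_mem_swap: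
  assumes "subgroup D G" "x \<in> carrier G" "y \<in> carrier G" "commutator G x y \<in> D"
  shows "commutator G y x \<in> D"
proof -
  have "commutator G y x = inv (commutator G x y)"
    using assms(2,3) by (simp add: commutator_def inv_mult_group m_assoc)
  then show ?thesis
    using assms(1,4) by (simp add: subgroup.m_inv_closed)
qed

text \<open>The identity [hk, z] = k^-1 [h, z] k [k, z] and its analogue for inverses show that,
  modulo the normal subgroup \<open>D\<close>, the elements commuting with \<open>z\<close> are
  closed under products and inverses.\<close>

lemma commutator_mem_generate_left:
  assumes D: "D \<lhd> G" and S: "S \<subseteq> carrier G" and z: "z \<in> carrier G"
    and comm: "\<And>s. s \<in> S \<Longrightarrow> commutator G s z \<in> D" and x: "x \<in> generate G S"
  shows "commutator G x z \<in> D"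
  using x
proof (induction rule: generate.induct)
  case one
  then show ?case
    using z normal_imp_subgroup[OF D] by (simp add: commutator_def subgroup.one_closed)
next
  case (incl h)
  then show ?case by (rule comm)
next
  case (inv h)
  have h: "h \<in> carrier G" using inv S by blast
  have "commutator G (inv h) z = h \<otimes> inv (commutator G h z) \<otimes> inv h"
    using h z by (simp add: commutator_def inv_mult_group m_assoc)
  then show ?case
    using normal.inv_op_closed2[OF D h] subgroup.m_inv_closed[OF normal_imp_subgroup[OF D] comm[OF inv]]
    by simp
next
  case (eng h k)
  have hk: "h \<in> carrier G" "k \<in> carrier G"
    using eng generate_in_carrier[OF S] by auto
  have "commutator G (h \<otimes> k) z = (inv k \<otimes> commutator G h z \<otimes> k) \<otimes> commutator G k z"
    using hk z by (simp add: commutator_def inv_mult_group m_assoc mult_inv_cancel_left)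
  then show ?case
    using normal.inv_op_closed1[OF D hk(2) eng.IH(1)] eng.IH(2)
      subgroup.m_closed[OF normal_imp_subgroup[OF D]] by simp
qed

lemma commutator_mem_generate_right:
  assumes D: "D \<lhd> G" and S: "S \<subseteq> carrier G" and z: "z \<in> carrier G"
    and comm: "\<And>s. s \<in> S \<Longrightarrow> commutator G z s \<in> D" and x: "x \<in> generate G S"
  shows "commutator G z x \<in> D"
  using commutator_mem_generate_left[OF D S z _ x] commutator_mem_swap[OF normal_imp_subgroup[OF D]]
    comm S z x generate_in_carrier[OF S] by (meson subsetD)

text \<open>Conjugating [w x w^-1, y] by \<open>w\<close> gives [x, w^-1 y w]. Commutators with
  conjugates of \<open>y\<close> thus reduce to commutators with \<open>y\<close> itself; this is
  applied to the conjugates of \<open>g\<close>.\<close>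

lemma conj_commutator_mem_right:
  assumes D: "D \<lhd> G" and xy: "x \<in> carrier G" "y \<in> carrier G" and w: "w \<in> carrier G"
    and comm: "commutator G (w \<otimes> x \<otimes> inv w) y \<in> D"
  shows "commutator G x (inv w \<otimes> y \<otimes> w) \<in> D"
proof -
  have "commutator G x (inv w \<otimes> y \<otimes> w) = inv w \<otimes> commutator G (w \<otimes> x \<otimes> inv w) y \<otimes> w"
    using xy w by (simp add: commutator_def inv_mult_group m_assoc mult_inv_cancel_left)
  then show ?thesis
    using normal.inv_op_closed1[OF D w comm] by simp
qed

lemma conj_generate_mem:
  assumes S: "S \<subseteq> carrier G" and u: "u \<in> carrier G" and K: "subgroup K G"
    and conj: "\<And>s. s \<in> S \<Longrightarrow> inv u \<otimes> s \<otimes> u \<in> K" and x: "x \<in> generate G S"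
  shows "inv u \<otimes> x \<otimes> u \<in> K"
  using x
proof (induction rule: generate.induct)
  case one
  then show ?case using u K by (simp add: subgroup.one_closed)
next
  case (incl h)
  then show ?case by (rule conj)
next
  case (inv h)
  have h: "h \<in> carrier G" using inv S by blast
  have "inv u \<otimes> inv h \<otimes> u = inv (inv u \<otimes> h \<otimes> u)"
    using h u by (simp add: inv_mult_group m_assoc)
  then show ?case using subgroup.m_inv_closed[OF K conj[OF inv]] by simp
next
  case (eng h k)
  have hk: "h \<in> carrier G" "k \<in> carrier G"
    using eng generate_in_carrier[OF S] by auto
  have "inv u \<otimes> (h \<otimes> k) \<otimes> u = (inv u \<otimes> h \<otimes> u) \<otimes> (inv u \<otimes> k \<otimes> u)"
    using hk u by (simp add: m_assoc mult_inv_cancel_left)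
  then show ?case using subgroup.m_closed[OF K eng.IH] by simp
qed

lemma normal_if_conj_generators:
  assumes A: "subgroup A G" and S: "S \<subseteq> carrier G" and gen: "generate G S = carrier G"
    and conj1: "\<And>s a. s \<in> S \<Longrightarrow> a \<in> A \<Longrightarrow> s \<otimes> a \<otimes> inv s \<in> A"
    and conj2: "\<And>s a. s \<in> S \<Longrightarrow> a \<in> A \<Longrightarrow> inv s \<otimes> a \<otimes> s \<in> A"
  shows "A \<lhd> G"
proof (rule normal_invI[OF A])
  fix x a assume "x \<in> carrier G" "a \<in> A"
  then have "x \<in> generate G S" using gen by simp
  then show "x \<otimes> a \<otimes> inv x \<in> A"
    using \<open>a \<in> A\<close>
  proof (induction arbitrary: a rule: generate.induct)
    case one
    then show ?case using subgroup.mem_carrier[OF A] by simp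
  next
    case (incl h)
    then show ?case by (simp add: conj1)
  next
    case (inv h)
    then show ?case using S by (simp add: conj2 subset_iff)
  next
    case (eng h k)
    have hk: "h \<in> carrier G" "k \<in> carrier G" "a \<in> carrier G"
      using eng generate_in_carrier[OF S] subgroup.mem_carrier[OF A] by auto
    have "h \<otimes> k \<otimes> a \<otimes> inv (h \<otimes> k) = h \<otimes> (k \<otimes> a \<otimes> inv k) \<otimes> inv h"
      using hk by (simp add: inv_mult_group m_assoc)
    then show ?case using eng by simp
  qed
qed

end

section \<open>Left-normed commutators under homomorphisms and conjugation\<close>

lemma left_normed_commutator_Nil [simp]: "left_normed_commutator G x [] = x"
  and left_normed_commutator_snoc:
    "left_normed_commutator G x (as @ [a]) = commutator G (left_normed_commutator G x as) a"
  by (simp_all add: left_normed_commutator_def)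

lemma left_normed_commutator_Suc:
  "left_normed_commutator G x (replicate (Suc n) g) =
    commutator G (left_normed_commutator G x (replicate n g)) g"
  by (simp only: replicate_Suc replicate_append_same[symmetric] left_normed_commutator_snoc)

lemma (in group) left_normed_commutator_closed:
  "x \<in> carrier G \<Longrightarrow> g \<in> carrier G \<Longrightarrow> left_normed_commutator G x (replicate n g) \<in> carrier G"
  by (induction n) (simp_all only: replicate_0 left_normed_commutator_Nil left_normed_commutator_Suc commutator_closed)

lemma (in group_hom) hom_commutator:
  "x \<in> carrier G \<Longrightarrow> y \<in> carrier G \<Longrightarrow> h (commutator G x y) = commutator H (h x) (h y)"
  by (simp add: commutator_def)

lemma (in group_hom) hom_left_normed_commutator:
  assumes "x \<in> carrier G" "g \<in> carrier G"
  shows "h (left_normed_commutator G x (replicate n g)) = left_normed_commutator H (h x) (replicate n (h g))"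
  by (induction n)
     (simp_all only: replicate_0 left_normed_commutator_Nil left_normed_commutator_Suc hom_commutator
       G.left_normed_commutator_closed assms)

lemma (in group) group_hom_conj:
  assumes u: "u \<in> carrier G" and H: "H \<lhd> G"
  shows "group_hom (G\<lparr>carrier := H\<rparr>) (G\<lparr>carrier := H\<rparr>) (\<lambda>x. inv u \<otimes> x \<otimes> u)"
proof -
  interpret H: normal H G by (fact H)
  have "(\<lambda>x. inv u \<otimes> x \<otimes> u) \<in> hom (G\<lparr>carrier := H\<rparr>) (G\<lparr>carrier := H\<rparr>)"
    using u H.inv_op_closed1 by (auto simp: hom_def m_assoc mult_inv_cancel_left)
  moreover have "group (G\<lparr>carrier := H\<rparr>)"
    by (simp add: H.is_subgroup subgroup_imp_group)
  ultimately show ?thesis by (simp add: group_hom_def group_hom_axioms_def)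
qed

lemma (in group) coset_eq_iff:
  assumes V: "subgroup V G" and "x \<in> carrier G" "y \<in> carrier G"
  shows "V #> x = V #> y \<longleftrightarrow> x \<otimes> inv y \<in> V"
  using assms by (metis coset_join1 coset_join2 coset_mult_inv1 coset_mult_inv2 inv_closed m_closed
      subgroup.subset)

text \<open>Conjugation by \<open>u\<close> is an automorphism fixing \<open>g\<close> modulo
  \<open>V\<close>, so modulo \<open>V\<close> it carries [x, g, ..., g] to [u^-1 x u, g, ..., g].
  This is why elements centralising \<open>g\<close> normalise the Engel subgroup.\<close>

lemma (in group) conj_left_normed_commutator_mod:
  assumes V: "V \<lhd> G" and x: "x \<in> carrier G" and g: "g \<in> carrier G" and u: "u \<in> carrier G"
    and comm: "commutator G u g \<in> V"
  shows "\<exists>v\<in>V. inv u \<otimes> left_normed_commutator G x (replicate n g) \<otimes> u =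
           v \<otimes> left_normed_commutator G (inv u \<otimes> x \<otimes> u) (replicate n g)"
proof -
  interpret V: normal V G by (fact V)
  interpret C: group_hom G G "\<lambda>x. inv u \<otimes> x \<otimes> u"
    using group_hom_conj[OF u normal_self] by simp
  interpret Q: group "G Mod V" by (rule V.factorgroup_is_group)
  interpret \<pi>: group_hom G "G Mod V" "\<lambda>x. V #> x"
    using V.r_coset_hom_Mod by (unfold_locales) auto
  let ?c = "\<lambda>x y. left_normed_commutator G x (replicate n y)"
  have "inv u \<otimes> g \<otimes> u \<otimes> inv g = g \<otimes> commutator G g u \<otimes> inv g"
    using u g by (simp add: commutator_def inv_mult_group m_assoc mult_inv_cancel_left)
  then have "inv u \<otimes> g \<otimes> u \<otimes> inv g \<in> V"
    using V.inv_op_closed2 commutator_mem_swap[OF V.is_subgroup u g comm] g by simp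
  then have g_eq: "V #> (inv u \<otimes> g \<otimes> u) = V #> g"
    using g u by (subst coset_eq_iff[OF V.is_subgroup]) auto
  have "V #> (inv u \<otimes> ?c x g \<otimes> u) = V #> ?c (inv u \<otimes> x \<otimes> u) g"
    using x g u C.hom_left_normed_commutator[of x g n]
    by (simp add: \<pi>.hom_left_normed_commutator g_eq)
  then have "inv u \<otimes> ?c x g \<otimes> u \<otimes> inv (?c (inv u \<otimes> x \<otimes> u) g) \<in> V"
    using x g u by (subst (asm) coset_eq_iff[OF V.is_subgroup]) (auto simp: left_normed_commutator_closed)
  then show ?thesis
    using x g u by (intro bexI) (auto simp: left_normed_commutator_closed m_assoc)
qed

section \<open>Engel subgroups and chief factors\<close>

lemma (in group) derived_less_if_solvable:
  assumes sol: "solvable G" and W: "subgroup W G" and nontriv: "W \<noteq> {\<one>}"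
  shows "derived G W \<subset> W"
proof (rule psubsetI)
  show "derived G W \<subseteq> W"
    by (rule derived_incl[OF subset_refl W])
  show "derived G W \<noteq> W"
  proof
    assume eq: "derived G W = W"
    obtain n where "(derived G ^^ n) W = {\<one>}"
      using solvable_imp_trivial_derived_seq[OF solvable_subgroup[OF W sol]] by blast
    moreover have "(derived G ^^ n) W = W"
      by (induction n) (simp_all add: eq)
    ultimately show False
      using nontriv by simp
  qed
qed

text \<open>Inverting both entries translates between \<open>commutator\<close> and the convention
  of \<open>derived_set\<close>.\<close>

lemma (in group) commutator_mem_derived:
  assumes W: "subgroup W G" and "a \<in> W" "b \<in> W"
  shows "commutator G a b \<in> derived G W"
proof -
  have "commutator G a b = inv a \<otimes> inv b \<otimes> inv (inv a) \<otimes> inv (inv b)"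
    using assms subgroup.mem_carrier[OF W] by (simp add: commutator_def)
  also have "\<dots> \<in> derived_set G W"
    using assms subgroup.m_inv_closed[OF W] by blast
  finally show ?thesis
    unfolding derived_def by (rule generate.incl)
qed

text \<open>Since x^-1 g x = g [g, x], such a \<open>K\<close> contains every conjugate of
  \<open>g\<close>.\<close>

lemma (in group) generated_by_conjugates_subset:
  assumes g: "g \<in> carrier G"
    and gen: "generate G ((\<lambda>x. inv x \<otimes> g \<otimes> x) ` carrier G) = carrier G"
    and K: "subgroup K G" "g \<in> K" "\<And>x. x \<in> carrier G \<Longrightarrow> commutator G x g \<in> K"
  shows "K = carrier G"
proof -
  have "inv x \<otimes> g \<otimes> x \<in> K" if x: "x \<in> carrier G" for x
  proof -
    have "inv x \<otimes> g \<otimes> x = g \<otimes> commutator G g x"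
      using x g by (simp add: commutator_def m_assoc mult_inv_cancel_left)
    then show ?thesis
      using commutator_mem_swap[OF K(1) x g K(3)[OF x]] K by (simp add: subgroup.m_closed)
  qed
  then have "generate G ((\<lambda>x. inv x \<otimes> g \<otimes> x) ` carrier G) \<subseteq> K"
    by (intro generate_subgroup_incl K) auto
  then show ?thesis
    using gen subgroup.subset[OF K(1)] by auto
qed

text \<open>One step down a chief series, carried out in \<open>G\<close> instead of
  \<open>G Mod V\<close>: congruences become memberships in \<open>V\<close>, and
  \<open>generate G (T \<union> V)\<close> is the full preimage of the Engel subgroup of the
  quotient.\<close>

lemma (in group) engel_chief_step:
  fixes g n
  defines "T \<equiv> {left_normed_commutator G x (replicate n g) | x. x \<in> carrier G}"
  assumes g: "g \<in> carrier G"
    and gen: "generate G ((\<lambda>x. inv x \<otimes> g \<otimes> x) ` carrier G) = carrier G"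
    and V: "V \<lhd> G" and W: "W \<lhd> G" and VW: "V \<subset> W" and abel: "derived G W \<subseteq> V"
    and chief: "\<And>Y. Y \<lhd> G \<Longrightarrow> V \<subseteq> Y \<Longrightarrow> Y \<subseteq> W \<Longrightarrow> Y = V \<or> Y = W"
    and cover: "\<And>x. x \<in> carrier G \<Longrightarrow> commutator G x g \<in> generate G (T \<union> W)"
    and x: "x \<in> carrier G"
  shows "commutator G x g \<in> generate G (T \<union> V)"
proof -
  interpret V: normal V G by (fact V)
  interpret W: normal W G by (fact W)
  have T: "T \<subseteq> carrier G"
    unfolding T_def using g left_normed_commutator_closed by auto
  define E where "E = generate G (T \<union> V)"
  have TV: "T \<union> V \<subseteq> carrier G" using T V.subset by blast
  interpret E: subgroup E G unfolding E_def by (rule generate_is_subgroup[OF TV])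
  have T_E: "T \<subseteq> E" and V_E: "V \<subseteq> E"
    unfolding E_def by (auto intro: generate.incl)

  \<comment> \<open>By \<open>cover\<close>, such a \<open>K\<close> contains every [x, g]. In
    particular \<open>T\<close>, \<open>W\<close> and \<open>g\<close> generate \<open>G\<close>, so
    normality and centrality can be tested on these generators.\<close>
  have top: "K = carrier G" if "subgroup K G" "T \<subseteq> K" "W \<subseteq> K" "g \<in> K" for K
  proof (rule generated_by_conjugates_subset[OF g gen])
    fix x assume "x \<in> carrier G"
    then show "commutator G x g \<in> K"
      using cover generate_subgroup_incl[of "T \<union> W" K] that by blast
  qed (use that in auto)
  define S where "S = T \<union> W \<union> {g}"
  have S: "S \<subseteq> carrier G" unfolding S_def using T W.subset g by auto
  have gen_S: "generate G S = carrier G"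
    by (rule top) (use generate_is_subgroup[OF S] in \<open>auto simp: S_def generate.incl\<close>)

  \<comment> \<open>The key observation, modulo \<open>V\<close>: whatever centralises
    \<open>g\<close> normalises \<open>E\<close>, because conjugation by it permutes the generators
    in \<open>T\<close> up to factors in \<open>V\<close>.\<close>
  have conj_E: "inv u \<otimes> e \<otimes> u \<in> E"
    if u: "u \<in> carrier G" "commutator G u g \<in> V" and e: "e \<in> E" for u e
  proof (rule conj_generate_mem[OF TV u(1) E.subgroup_axioms _ e[unfolded E_def]])
    fix s assume "s \<in> T \<union> V"
    then show "inv u \<otimes> s \<otimes> u \<in> E"
    proof
      assume "s \<in> V"
      then show ?thesis using V.inv_op_closed1 u(1) V_E by blast
    next
      assume "s \<in> T"
      then obtain x where x: "x \<in> carrier G" and s: "s = left_normed_commutator G x (replicate n g)"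
        unfolding T_def by auto
      obtain v where "v \<in> V"
        "inv u \<otimes> s \<otimes> u = v \<otimes> left_normed_commutator G (inv u \<otimes> x \<otimes> u) (replicate n g)"
        using conj_left_normed_commutator_mod[OF V x g u] s by auto
      moreover have "left_normed_commutator G (inv u \<otimes> x \<otimes> u) (replicate n g) \<in> T"
        unfolding T_def using x u by auto
      ultimately show ?thesis using V_E T_E by auto
    qed
  qed
  have comm_gg: "commutator G g g \<in> V" "commutator G (inv g) g \<in> V"
    using g by (simp_all add: commutator_def m_assoc mult_inv_cancel_left)
  have conj_g: "inv g \<otimes> e \<otimes> g \<in> E" "g \<otimes> e \<otimes> inv g \<in> E" if "e \<in> E" for e
    using conj_E[OF g comm_gg(1) that] conj_E[OF inv_closed[OF g] comm_gg(2) that] g by simp_all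
  have comm_W: "commutator G a b \<in> V" if "a \<in> W" "b \<in> W" for a b
    using commutator_mem_derived[OF W.subgroup_axioms that] abel by blast
  have conj_mem: "inv w \<otimes> a \<otimes> w \<in> A"
    if "w \<in> carrier G" "a \<in> A" "subgroup A G" "commutator G a w \<in> A" for w a A
  proof -
    have "inv w \<otimes> a \<otimes> w = a \<otimes> commutator G a w"
      using that subgroup.mem_carrier[OF that(3,2)]
      by (simp add: commutator_def m_assoc mult_inv_cancel_left)
    then show ?thesis using that by (simp add: subgroup.m_closed)
  qed
  have conj_W: "w \<otimes> a \<otimes> inv w \<in> E \<and> inv w \<otimes> a \<otimes> w \<in> E"
    if w: "w \<in> W" and a: "a \<in> E" and comm: "\<And>w. w \<in> W \<Longrightarrow> commutator G a w \<in> V" for w a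
  proof
    have iw: "inv w \<in> W" using w by simp
    have "commutator G a w \<in> E" "commutator G a (inv w) \<in> E"
      using comm[OF w] comm[OF iw] V_E by auto
    then show "inv w \<otimes> a \<otimes> w \<in> E" "w \<otimes> a \<otimes> inv w \<in> E"
      using conj_mem[OF _ a E.subgroup_axioms, of w] conj_mem[OF _ a E.subgroup_axioms, of "inv w"] w
      by simp_all
  qed

  show ?thesis
  proof (cases "E \<inter> W = V")
    \<comment> \<open>Each kind of generator normalises the intersection of \<open>E\<close> and
      \<open>W\<close>: \<open>T\<close> lies in \<open>E\<close>, \<open>W\<close> is abelian
      modulo \<open>V\<close>, and \<open>g\<close> normalises \<open>E\<close>. By
      \<open>chief\<close> the intersection is then all of \<open>W\<close>, so \<open>E\<close>
      already contains \<open>W\<close>.\<close>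
    case False
    have "E \<inter> W \<lhd> G"
    proof (rule normal_if_conj_generators[OF _ S gen_S])
      show "subgroup (E \<inter> W) G"
        by (rule subgroups_Inter_pair[OF E.subgroup_axioms W.subgroup_axioms])
    next
      fix s a assume sa: "s \<in> S" "a \<in> E \<inter> W"
      have inW: "s \<otimes> a \<otimes> inv s \<in> W" "inv s \<otimes> a \<otimes> s \<in> W"
        using sa S W.inv_op_closed1 W.inv_op_closed2 by auto
      have "s \<otimes> a \<otimes> inv s \<in> E \<and> inv s \<otimes> a \<otimes> s \<in> E"
        using sa(1) unfolding S_def
      proof (elim UnE)
        assume "s \<in> T"
        then show ?thesis using T_E sa by auto
      next
        assume s: "s \<in> W"
        show ?thesis by (rule conj_W[OF s]) (use sa comm_W in auto)
      next
        assume "s \<in> {g}"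
        then show ?thesis using conj_g sa by simp
      qed
      then show "s \<otimes> a \<otimes> inv s \<in> E \<inter> W" "inv s \<otimes> a \<otimes> s \<in> E \<inter> W"
        using inW by auto
    qed
    then have "E \<inter> W = W"
      using chief[of "E \<inter> W"] V_E VW False by auto
    then have "generate G (T \<union> W) \<subseteq> E"
      using T_E by (intro generate_subgroup_incl) (auto intro: E.subgroup_axioms)
    then show ?thesis
      using cover[OF x] unfolding E_def by blast
  next
    case EW: True
    \<comment> \<open>The full preimage of the centraliser of \<open>g\<close> in W/V. The aim is to
      show that it is \<open>W\<close> and that W/V is central in G/V.\<close>
    define C where "C = {u \<in> W. commutator G u g \<in> V}"
    have C_carr: "C \<subseteq> carrier G" and V_C: "V \<subseteq> C"
    proof -
      show "C \<subseteq> carrier G" unfolding C_def using W.subset by auto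
      have "commutator G v g \<in> V" if "v \<in> V" for v
      proof -
        have "commutator G v g = inv v \<otimes> (inv g \<otimes> v \<otimes> g)"
          using g that by (simp add: commutator_def m_assoc)
        then show ?thesis using V.inv_op_closed1[OF g that] that by simp
      qed
      then show "V \<subseteq> C" unfolding C_def using VW by auto
    qed
    \<comment> \<open>For \<open>s\<close> in \<open>T\<close>, the commutator lies in
      \<open>W\<close> because \<open>W\<close> is normal, and in \<open>E\<close> because
      \<open>u\<close> normalises \<open>E\<close>; hence it lies in \<open>V\<close> by
      \<open>EW\<close>.\<close>
    have comm_C: "commutator G u s \<in> V" if u: "u \<in> C" and s: "s \<in> S" for u s
    proof -
      have uc: "u \<in> carrier G" "u \<in> W" "commutator G u g \<in> V"
        using u C_carr unfolding C_def by auto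
      consider "s \<in> T" | "s \<in> W" | "s = g" using s unfolding S_def by blast
      then show ?thesis
      proof cases
        case 1
        have sc: "s \<in> carrier G" using 1 T by auto
        have "commutator G s u = inv s \<otimes> (inv u \<otimes> s \<otimes> u)"
          using uc sc by (simp add: commutator_def m_assoc)
        also have "\<dots> \<in> E"
          using conj_E[OF uc(1,3)] 1 T_E by auto
        finally have "commutator G s u \<in> E" .
        moreover have "commutator G s u \<in> W"
          unfolding commutator_def using W.inv_op_closed1[OF sc] uc sc
          by (simp add: W.m_closed)
        ultimately show ?thesis
          using commutator_mem_swap[OF V.subgroup_axioms sc uc(1)] EW by auto
      qed (use uc comm_W in auto)
    qed
    have comm_C_G: "commutator G u y \<in> V" if u: "u \<in> C" and y: "y \<in> carrier G" for u y
      by (rule commutator_mem_generate_right[OF V S]) (use comm_C u y C_carr gen_S in auto)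
    have C_sub: "subgroup C G"
    proof (rule subgroupI[OF C_carr])
      show "C \<noteq> {}" using V_C subgroup.one_closed[OF V.subgroup_axioms] by (metis subsetD empty_iff)
    next
      fix a assume a: "a \<in> C"
      then have "inv a \<in> W" unfolding C_def by auto
      moreover have "commutator G (inv a) g \<in> V"
      proof (rule commutator_mem_generate_left[OF V, where S = "{a}"])
        show "inv a \<in> generate G {a}"
          by (intro generate.inv) simp
      qed (use a C_carr g in \<open>auto simp: C_def\<close>)
      ultimately show "inv a \<in> C" unfolding C_def by blast
    next
      fix a b assume ab: "a \<in> C" "b \<in> C"
      then have "a \<otimes> b \<in> W" unfolding C_def by auto
      moreover have "commutator G (a \<otimes> b) g \<in> V"
      proof (rule commutator_mem_generate_left[OF V, where S = "{a, b}"])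
        show "a \<otimes> b \<in> generate G {a, b}"
          by (intro generate.eng generate.incl) simp_all
      qed (use ab C_carr g in \<open>auto simp: C_def\<close>)
      ultimately show "a \<otimes> b \<in> C" unfolding C_def by blast
    qed
    have "C \<lhd> G"
    proof (rule normal_invI[OF C_sub])
      fix y a assume "y \<in> carrier G" "a \<in> C"
      then show "y \<otimes> a \<otimes> inv y \<in> C"
        using conj_mem[of "inv y" a C] C_sub comm_C_G[of a "inv y"] V_C by auto
    qed
    \<comment> \<open>Start from \<open>w\<close> in \<open>W\<close> outside \<open>V\<close> and
      commutate repeatedly with \<open>g\<close>. The sequence stays in \<open>W\<close>, and its
      \<open>n\<close>-th term also lies in \<open>E\<close>, hence in \<open>V\<close>. The term
      just before the first entry into \<open>V\<close> lies in \<open>C\<close> but not in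
      \<open>V\<close>.\<close>
    moreover have "C \<noteq> V"
    proof -
      obtain w where w: "w \<in> W" "w \<notin> V" using VW by blast
      define f where "f i = left_normed_commutator G w (replicate i g)" for i
      have f_Suc: "f (Suc i) = commutator G (f i) g" for i
        unfolding f_def by (rule left_normed_commutator_Suc)
      have f_W: "f i \<in> W" for i
      proof (induction i)
        case (Suc i)
        have "f (Suc i) = inv (f i) \<otimes> (inv g \<otimes> f i \<otimes> g)"
          using Suc g unfolding f_Suc by (simp add: commutator_def m_assoc)
        then show ?case using Suc W.inv_op_closed1[OF g Suc] by simp
      qed (use w in \<open>simp add: f_def\<close>)
      have "f n \<in> V"
        using f_W[of n] T_E w W.mem_carrier EW unfolding f_def T_def by blast
      then have ex: "\<exists>i. f i \<in> V" ..
      define m where "m = (LEAST i. f i \<in> V)"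
      have m: "f m \<in> V" unfolding m_def by (rule LeastI_ex[OF ex])
      have "m \<noteq> 0" using m w unfolding f_def by (metis left_normed_commutator_Nil replicate_0)
      then obtain i where i: "m = Suc i" by (cases m) auto
      have "f i \<notin> V" using not_less_Least[of i "\<lambda>i. f i \<in> V"] i unfolding m_def by auto
      moreover have "f i \<in> C" using f_W m unfolding C_def i f_Suc by auto
      ultimately show ?thesis by blast
    qed
    moreover have "C \<subseteq> W" unfolding C_def by blast
    ultimately have CW: "C = W" using chief V_C by blast
    \<comment> \<open>\<open>W\<close> is now central modulo \<open>V\<close>, so conjugation by
      \<open>W\<close> changes elements of \<open>E\<close> only by factors in \<open>V\<close>; the
      generators in \<open>T\<close> and \<open>g\<close> normalise \<open>E\<close> anyway.\<close>
    have "E \<lhd> G"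
    proof (rule normal_if_conj_generators[OF E.subgroup_axioms S gen_S])
      fix s a assume sa: "s \<in> S" "a \<in> E"
      have "commutator G a w \<in> V" if "w \<in> W" for w
        using comm_C_G[of w a] CW that sa commutator_mem_swap[OF V.subgroup_axioms, of w a] by auto
      then have W_case: "s \<in> W \<Longrightarrow> s \<otimes> a \<otimes> inv s \<in> E \<and> inv s \<otimes> a \<otimes> s \<in> E"
        using conj_W sa(2) by blast
      have "s \<otimes> a \<otimes> inv s \<in> E \<and> inv s \<otimes> a \<otimes> s \<in> E"
        using sa(1) unfolding S_def
      proof (elim UnE)
        assume "s \<in> T"
        then show ?thesis using T_E sa by auto
      qed (use W_case conj_g sa in auto)
      then show "s \<otimes> a \<otimes> inv s \<in> E" "inv s \<otimes> a \<otimes> s \<in> E" by auto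
    qed
    \<comment> \<open>Modulo the normal subgroup \<open>E\<close> all generators commute with
      \<open>g\<close>: those in \<open>T\<close> become trivial, and those in \<open>W\<close> =
      \<open>C\<close> commute with \<open>g\<close> even modulo \<open>V\<close>. Hence
      \<open>g\<close> is central in G/E.\<close>
    moreover have "commutator G s g \<in> E" if s: "s \<in> S" for s
      using s unfolding S_def
    proof (elim UnE)
      assume "s \<in> T"
      then have sE: "s \<in> E" using T_E by blast
      then have "commutator G s g = inv s \<otimes> (inv g \<otimes> s \<otimes> g)"
        using g by (simp add: commutator_def m_assoc)
      then show ?thesis using conj_g sE by simp
    next
      assume "s \<in> W"
      then show ?thesis using CW V_E unfolding C_def by blast
    qed (use comm_gg V_E in auto)
    ultimately have "commutator G x g \<in> E"
      by (rule commutator_mem_generate_left[OF _ S g]) (use x gen_S in auto)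
    then show ?thesis unfolding E_def .
  qed
qed

theorem (in group) commutator_mem_engel_subgroup:
  assumes fin: "finite (carrier G)" and sol: "solvable G" and g: "g \<in> carrier G"
    and gen: "generate G ((\<lambda>x. inv x \<otimes> g \<otimes> x) ` carrier G) = carrier G"
    and x: "x \<in> carrier G"
  shows "commutator G x g \<in> engel_subgroup G n g"
proof -
  define T where "T = {left_normed_commutator G x (replicate n g) | x. x \<in> carrier G}"
  \<comment> \<open>Choosing \<open>W\<close> of least order with this property replaces the descent
    along a chief series: \<open>carrier G\<close> has the property, and
    \<open>engel_chief_step\<close> would yield a smaller \<open>W\<close> unless \<open>W\<close>
    is trivial.\<close>
  define P where "P W \<longleftrightarrow> W \<lhd> G \<and> (\<forall>x\<in>carrier G. commutator G x g \<in> generate G (T \<union> W))" for W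
  have "P (carrier G)"
    unfolding P_def using normal_self g by (auto intro: generate.incl)
  then obtain W where W: "P W" and least: "\<And>Y. P Y \<Longrightarrow> card W \<le> card Y"
    using ex_has_least_nat[of P _ card] by blast
  have fin': "finite Y" if "Y \<lhd> G" for Y
    using that fin by (meson finite_subset normal_imp_subgroup subgroup.subset)
  have W_normal: "W \<lhd> G" using W unfolding P_def by blast
  have "W = {\<one>}"
  proof (rule ccontr)
    assume "W \<noteq> {\<one>}"
    \<comment> \<open>A maximal member \<open>V\<close> makes W/V an abelian chief factor.
      Solvability makes the family nonempty, as it then contains the derived subgroup of
      \<open>W\<close>.\<close>
    define \<V> where "\<V> = {V. V \<lhd> G \<and> derived G W \<subseteq> V \<and> V \<subset> W}"
    have "derived G W \<in> \<V>"
      unfolding \<V>_def using derived_is_normal[OF W_normal]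
        derived_less_if_solvable[OF sol normal_imp_subgroup[OF W_normal] \<open>W \<noteq> {\<one>}\<close>] by blast
    moreover have "finite \<V>"
      by (rule finite_subset[of _ "Pow W"]) (auto simp: \<V>_def fin'[OF W_normal])
    ultimately obtain V where V: "V \<in> \<V>" and max: "\<And>Y. Y \<in> \<V> \<Longrightarrow> V \<subseteq> Y \<Longrightarrow> Y = V"
      using finite_has_maximal[of \<V>] by blast
    have V': "V \<lhd> G" "derived G W \<subseteq> V" "V \<subset> W" using V unfolding \<V>_def by auto
    have "Y = V \<or> Y = W" if "Y \<lhd> G" "V \<subseteq> Y" "Y \<subseteq> W" for Y
      using max[of Y] that V' unfolding \<V>_def by blast
    then have "P V"
      using engel_chief_step[OF g gen V'(1) W_normal V'(3,2), of n] V'(1) W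
      unfolding P_def T_def by blast
    then show False
      using least[of V] psubset_card_mono[OF fin'[OF W_normal] V'(3)] by simp
  qed
  moreover have "generate G (T \<union> {\<one>}) \<subseteq> generate G T"
    by (rule generate_subgroup_incl)
      (use g left_normed_commutator_closed in
        \<open>auto simp: T_def intro: generate.incl generate.one generate_is_subgroup\<close>)
  ultimately show ?thesis
    using W x unfolding P_def engel_subgroup_def T_def by blast
qed

section \<open>Fitting subgroups\<close>

context group
begin

lemma commutator_mem_normal:
  assumes N: "N \<lhd> G" and a: "a \<in> N" and b: "b \<in> carrier G"
  shows "commutator G a b \<in> N" and "commutator G b a \<in> N"
proof -
  have sub: "subgroup N G" by (rule normal_imp_subgroup[OF N])
  have ac: "a \<in> carrier G" by (rule subgroup.mem_carrier[OF sub a])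
  have "commutator G a b = inv a \<otimes> (inv b \<otimes> a \<otimes> b)"
    using ac b by (simp add: commutator_def m_assoc)
  then show "commutator G a b \<in> N"
    using normal.inv_op_closed1[OF N b a] sub a
    by (simp add: subgroup.m_closed subgroup.m_inv_closed)
  then show "commutator G b a \<in> N"
    by (rule commutator_mem_swap[OF sub ac b])
qed

lemma conj_commutator:
  assumes "a \<in> carrier G" "b \<in> carrier G" "x \<in> carrier G"
  shows "x \<otimes> commutator G a b \<otimes> inv x = commutator G (x \<otimes> a \<otimes> inv x) (x \<otimes> b \<otimes> inv x)"
  using assms by (simp add: commutator_def inv_mult_group m_assoc mult_inv_cancel_left)

lemma commutator_consistent:
  assumes "subgroup H G" "a \<in> H" "b \<in> H"
  shows "commutator (G\<lparr>carrier := H\<rparr>) a b = commutator G a b"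
  using assms by (simp add: commutator_def m_inv_consistent)

lemma left_normed_commutator_consistent:
  assumes H: "subgroup H G" and x: "x \<in> H" and g: "g \<in> H"
  shows "left_normed_commutator (G\<lparr>carrier := H\<rparr>) x (replicate n g) =
    left_normed_commutator G x (replicate n g)"
proof -
  interpret H: group "G\<lparr>carrier := H\<rparr>" by (rule subgroup_imp_group[OF H])
  show ?thesis
  proof (induction n)
    case (Suc n)
    show ?case
      using H.left_normed_commutator_closed[of x g n] x g commutator_consistent[OF H]
      by (simp add: left_normed_commutator_Suc Suc del: replicate_Suc)
  qed simp
qed

section \<open>Lower central series of subgroups, and Fitting's theorem\<close>

lemma lower_central_subgroup: "subgroup (lower_central G i) G"
proof (induction i)
  case 0
  then show ?case by (simp add: subgroup_self)
next
  case (Suc i)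
  then show ?case
    using subgroup.mem_carrier[OF Suc] by (auto intro!: generate_is_subgroup)
qed

lemma lower_central_subset:
  assumes "subgroup T G"
  shows "lower_central (G\<lparr>carrier := T\<rparr>) i \<subseteq> T"
  using subgroup.subset[OF group.lower_central_subgroup[OF subgroup_imp_group[OF assms]]] by simp

lemma lower_central_is_subgroup:
  assumes "subgroup T G"
  shows "subgroup (lower_central (G\<lparr>carrier := T\<rparr>) i) G"
  using incl_subgroup[OF assms group.lower_central_subgroup[OF subgroup_imp_group[OF assms]]] .

text \<open>Expresses the series of \<open>T\<close> through commutators and generation in
  \<open>G\<close>, so that the series of different subgroups can be compared in one ambient
  group.\<close>

lemma lower_central_restrict_Suc:
  assumes T: "subgroup T G"
  shows "lower_central (G\<lparr>carrier := T\<rparr>) (Suc i) =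
    generate G {commutator G a b | a b. a \<in> lower_central (G\<lparr>carrier := T\<rparr>) i \<and> b \<in> T}"
proof -
  let ?L = "lower_central (G\<lparr>carrier := T\<rparr>) i"
  have sub: "?L \<subseteq> T" by (rule lower_central_subset[OF T])
  interpret T: group "G\<lparr>carrier := T\<rparr>" by (rule subgroup_imp_group[OF T])
  have "{commutator (G\<lparr>carrier := T\<rparr>) a b | a b. a \<in> ?L \<and> b \<in> T} =
      {commutator G a b | a b. a \<in> ?L \<and> b \<in> T}"
    using sub commutator_consistent[OF T] by (simp add: subset_iff cong: rev_conj_cong)
  moreover have "{commutator (G\<lparr>carrier := T\<rparr>) a b | a b. a \<in> ?L \<and> b \<in> T} \<subseteq> T"
    using T.commutator_closed sub by auto
  ultimately show ?thesis
    using generate_consistent[OF _ T] by simp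
qed

lemma commutator_mem_lower_central:
  assumes "subgroup T G" "a \<in> lower_central (G\<lparr>carrier := T\<rparr>) i" "b \<in> T"
  shows "commutator G a b \<in> lower_central (G\<lparr>carrier := T\<rparr>) (Suc i)"
  unfolding lower_central_restrict_Suc[OF assms(1)] by (rule generate.incl) (use assms in blast)

lemma lower_central_mono:
  assumes S: "subgroup S G" and T: "subgroup T G" and ST: "S \<subseteq> T"
  shows "lower_central (G\<lparr>carrier := S\<rparr>) i \<subseteq> lower_central (G\<lparr>carrier := T\<rparr>) i"
proof (induction i)
  case (Suc i)
  show ?case
    unfolding lower_central_restrict_Suc[OF S] lower_central_restrict_Suc[OF T]
    by (rule mono_generate) (use Suc ST in blast)
qed (use ST in simp)

lemma lower_central_normal:
  assumes T: "T \<lhd> G"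
  shows "lower_central (G\<lparr>carrier := T\<rparr>) i \<lhd> G"
proof (induction i)
  case (Suc i)
  have T': "subgroup T G" by (rule normal_imp_subgroup[OF T])
  show ?case
    unfolding lower_central_restrict_Suc[OF T']
  proof (rule normal_generateI)
    show "{commutator G a b | a b. a \<in> lower_central (G\<lparr>carrier := T\<rparr>) i \<and> b \<in> T} \<subseteq> carrier G"
      using subgroup.mem_carrier[OF T'] subgroup.mem_carrier[OF normal_imp_subgroup[OF Suc]] by auto
  next
    fix h x assume h: "h \<in> {commutator G a b | a b. a \<in> lower_central (G\<lparr>carrier := T\<rparr>) i \<and> b \<in> T}"
      and x: "x \<in> carrier G"
    then obtain a b where ab: "a \<in> lower_central (G\<lparr>carrier := T\<rparr>) i" "b \<in> T"
      and h: "h = commutator G a b" by blast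
    have "x \<otimes> h \<otimes> inv x = commutator G (x \<otimes> a \<otimes> inv x) (x \<otimes> b \<otimes> inv x)"
      unfolding h
      using ab x subgroup.mem_carrier[OF T'] subgroup.mem_carrier[OF normal_imp_subgroup[OF Suc]]
      by (intro conj_commutator) auto
    then show "x \<otimes> h \<otimes> inv x \<in>
        {commutator G a b | a b. a \<in> lower_central (G\<lparr>carrier := T\<rparr>) i \<and> b \<in> T}"
      using normal.inv_op_closed2[OF T x ab(2)] normal.inv_op_closed2[OF Suc x ab(1)] by blast
  qed
qed (use T in simp)

lemma lower_central_antimono:
  assumes T: "T \<lhd> G" and "i \<le> j"
  shows "lower_central (G\<lparr>carrier := T\<rparr>) j \<subseteq> lower_central (G\<lparr>carrier := T\<rparr>) i"
proof (rule lift_Suc_antimono_le[OF _ \<open>i \<le> j\<close>])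
  fix k
  have T': "subgroup T G" by (rule normal_imp_subgroup[OF T])
  show "lower_central (G\<lparr>carrier := T\<rparr>) (Suc k) \<subseteq> lower_central (G\<lparr>carrier := T\<rparr>) k"
    unfolding lower_central_restrict_Suc[OF T']
    by (rule generate_subgroup_incl)
      (use commutator_mem_normal[OF lower_central_normal[OF T]] subgroup.mem_carrier[OF T']
        lower_central_is_subgroup[OF T'] in auto)
qed

text \<open>
  With \<open>A\<close> and \<open>B\<close> the lower central series of \<open>M\<close> and \<open>N\<close>, shifted by one so that
  \<open>A 0 = B 0 = G\<close>, the subgroups \<open>D c\<close> generated by the \<open>A i \<inter> B (c - i)\<close> form a central series
  for \<open>MN\<close>.
\<close>

lemma nilpotent_generate_Un:
  assumes M: "M \<lhd> G" and N: "N \<lhd> G"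
    and a: "lower_central (G\<lparr>carrier := M\<rparr>) a = {\<one>}"
    and b: "lower_central (G\<lparr>carrier := N\<rparr>) b = {\<one>}"
  shows "\<exists>c. lower_central (G\<lparr>carrier := generate G (M \<union> N)\<rparr>) c = {\<one>}"
proof -
  have M': "subgroup M G" and N': "subgroup N G"
    using M N normal_imp_subgroup by auto
  define sh where "sh T i = (case i of 0 \<Rightarrow> carrier G | Suc j \<Rightarrow> lower_central (G\<lparr>carrier := T\<rparr>) j)"
    for T :: "'a set" and i
  have sh_normal: "sh T i \<lhd> G" if "T \<lhd> G" for T i
    unfolding sh_def by (cases i) (auto simp: normal_self lower_central_normal that)
  have sh_comm: "commutator G x y \<in> sh T (Suc i)" if T: "T \<lhd> G" and xy: "x \<in> sh T i" "y \<in> T" for T i x y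
  proof (cases i)
    case 0
    then show ?thesis
      using commutator_mem_normal(2)[OF T] xy unfolding sh_def by simp
  next
    case (Suc j)
    then show ?thesis
      using commutator_mem_lower_central[OF normal_imp_subgroup[OF T]] xy unfolding sh_def
      by (simp del: lower_central.simps)
  qed
  define U where "U c = (\<Union>i\<le>c. sh M i \<inter> sh N (c - i))" for c
  define D where "D c = generate G (U c)" for c
  have U_carr: "U c \<subseteq> carrier G" for c
    unfolding U_def using subgroup.subset[OF normal_imp_subgroup[OF sh_normal[OF M]]] by blast
  have D_normal: "D c \<lhd> G" for c
    unfolding D_def
  proof (rule normal_generateI[OF U_carr])
    fix h x assume "h \<in> U c" and x: "x \<in> carrier G"
    then obtain i where i: "i \<le> c" "h \<in> sh M i" "h \<in> sh N (c - i)"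
      unfolding U_def by auto
    then have "x \<otimes> h \<otimes> inv x \<in> sh M i \<inter> sh N (c - i)"
      using normal.inv_op_closed2[OF sh_normal[OF M] x] normal.inv_op_closed2[OF sh_normal[OF N] x]
      by simp
    then show "x \<otimes> h \<otimes> inv x \<in> U c"
      unfolding U_def using i(1) by blast
  qed
  have U_D: "x \<in> D (i + j)" if "x \<in> sh M i" "x \<in> sh N j" for x i j
    unfolding D_def
  proof (rule generate.incl)
    show "x \<in> U (i + j)"
      unfolding U_def using that by (intro UN_I[of i]) auto
  qed
  define K where "K = generate G (M \<union> N)"
  have MN: "M \<union> N \<subseteq> carrier G"
    using subgroup.subset[OF M'] subgroup.subset[OF N'] by blast
  have K: "subgroup K G"
    unfolding K_def by (rule generate_is_subgroup[OF MN])
  \<comment> \<open>A commutator with an element of \<open>M\<close> raises \<open>i\<close> by one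
    and keeps \<open>c - i\<close>; with an element of \<open>N\<close> it raises
    \<open>c - i\<close> and keeps \<open>i\<close>. Either way the total index becomes
    \<open>Suc c\<close>.\<close>
  have step: "commutator G x y \<in> D (Suc c)" if x: "x \<in> D c" and y: "y \<in> K" for x y c
  proof (rule commutator_mem_generate_left[OF D_normal U_carr _ _ x[unfolded D_def]])
    show "y \<in> carrier G" by (rule subgroup.mem_carrier[OF K y])
  next
    fix s assume "s \<in> U c"
    then obtain i where i: "i \<le> c" and s: "s \<in> sh M i" "s \<in> sh N (c - i)"
      unfolding U_def by auto
    have s_carr: "s \<in> carrier G"
      by (rule subgroup.mem_carrier[OF normal_imp_subgroup[OF sh_normal[OF M]] s(1)])
    show "commutator G s y \<in> D (Suc c)"
    proof (rule commutator_mem_generate_right[OF D_normal MN s_carr _ y[unfolded K_def]])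
      fix t assume t: "t \<in> M \<union> N"
      then have t_carr: "t \<in> carrier G" using MN by blast
      show "commutator G s t \<in> D (Suc c)"
        using t
      proof
        assume "t \<in> M"
        then show ?thesis
          using U_D[of "commutator G s t" "Suc i" "c - i"] sh_comm[OF M s(1)]
            commutator_mem_normal(1)[OF sh_normal[OF N] s(2) t_carr] i by simp
      next
        assume "t \<in> N"
        then show ?thesis
          using U_D[of "commutator G s t" i "Suc (c - i)"] sh_comm[OF N s(2)]
            commutator_mem_normal(1)[OF sh_normal[OF M] s(1) t_carr] i by simp
      qed
    qed
  qed
  have "lower_central (G\<lparr>carrier := K\<rparr>) c \<subseteq> D c" for c
  proof (induction c)
    case 0
    show ?case using U_D[of _ 0 0] subgroup.subset[OF K] by (auto simp: sh_def)
  next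
    case (Suc c)
    show ?case
      unfolding lower_central_restrict_Suc[OF K]
      by (rule generate_subgroup_incl) (use step Suc normal_imp_subgroup[OF D_normal] in auto)
  qed
  \<comment> \<open>The shifted series of \<open>M\<close> and \<open>N\<close> are trivial from the
    indices \<open>a + 1\<close> and \<open>b + 1\<close> on. Two indices with sum
    \<open>a + b + 2\<close> cannot both be smaller than these bounds.\<close>
  moreover have "D (a + b + 2) \<subseteq> {\<one>}"
    unfolding D_def
  proof (rule generate_subgroup_incl[OF _ triv_subgroup])
    show "U (a + b + 2) \<subseteq> {\<one>}"
    proof
      fix x assume "x \<in> U (a + b + 2)"
      then obtain i where i: "i \<le> a + b + 2" and x: "x \<in> sh M i" "x \<in> sh N (a + b + 2 - i)"
        unfolding U_def by auto
      show "x \<in> {\<one>}"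
      proof (cases "Suc a \<le> i")
        case True
        then obtain j where "i = Suc j" "a \<le> j" by (cases i) auto
        then show ?thesis
          using lower_central_antimono[OF M, of a j] x a unfolding sh_def by auto
      next
        case False
        then obtain j where "a + b + 2 - i = Suc j" "b \<le> j"
          by (cases "a + b + 2 - i") auto
        then show ?thesis
          using lower_central_antimono[OF N, of b j] x b unfolding sh_def by auto
      qed
    qed
  qed
  ultimately have "lower_central (G\<lparr>carrier := K\<rparr>) (a + b + 2) = {\<one>}"
    using subgroup.one_closed[OF lower_central_is_subgroup[OF K]] by blast
  then show ?thesis unfolding K_def ..
qed

text \<open>By \<open>nilpotent_generate_Un\<close> the normal nilpotent subgroups are closed under
  joins. In a finite group a maximal one exists and therefore contains all others, which gives
  \<open>GREATEST\<close> its intended value.\<close>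

lemma fitting_subgroup:
  assumes fin: "finite (carrier G)"
  shows fitting_subgroup_normal: "fitting_subgroup G \<lhd> G"
    and fitting_subgroup_nilpotent: "nilpotent_group (G\<lparr>carrier := fitting_subgroup G\<rparr>)"
    and fitting_subgroup_greatest:
      "N \<lhd> G \<Longrightarrow> nilpotent_group (G\<lparr>carrier := N\<rparr>) \<Longrightarrow> N \<subseteq> fitting_subgroup G"
proof -
  define P where "P N \<longleftrightarrow> N \<lhd> G \<and> nilpotent_group (G\<lparr>carrier := N\<rparr>)" for N
  have P_join: "P (generate G (M \<union> N))" if P: "P M" "P N" for M N
  proof -
    have MN: "M \<lhd> G" "N \<lhd> G" using P unfolding P_def by auto
    have carr: "M \<union> N \<subseteq> carrier G"
      using MN[THEN normal_imp_subgroup, THEN subgroup.subset] by blast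
    have "generate G (M \<union> N) \<lhd> G"
      by (rule normal_generateI[OF carr])
        (use normal.inv_op_closed2[OF MN(1)] normal.inv_op_closed2[OF MN(2)] in auto)
    moreover obtain a b where
      "lower_central (G\<lparr>carrier := M\<rparr>) a = {\<one>}" "lower_central (G\<lparr>carrier := N\<rparr>) b = {\<one>}"
      using P unfolding P_def nilpotent_group_def by auto
    note nilpotent_generate_Un[OF MN this]
    ultimately show ?thesis
      using subgroup_imp_group[OF generate_is_subgroup[OF carr]]
      unfolding P_def nilpotent_group_def by auto
  qed
  have "P {\<one>}"
    unfolding P_def nilpotent_group_def
    using one_is_normal normal_imp_subgroup[OF one_is_normal] subgroup_imp_group
    by (auto intro: exI[of _ 0])
  moreover have fin_P: "finite {N. P N}"
    by (rule finite_subset[of _ "Pow (carrier G)"])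
      (use fin subgroup.mem_carrier[OF normal_imp_subgroup] in \<open>auto simp: P_def\<close>)
  ultimately obtain M where M: "P M" and max: "\<And>N. P N \<Longrightarrow> M \<subseteq> N \<Longrightarrow> N = M"
    using finite_has_maximal[of "{N. P N}"] by blast
  have greatest: "N \<subseteq> M" if "P N" for N
    using max[OF P_join[OF M that]] generate.incl[of _ "M \<union> N" G] by blast
  have "fitting_subgroup G = M"
    unfolding fitting_subgroup_def P_def[symmetric]
    by (rule Greatest_equality) (use M greatest in auto)
  then show "fitting_subgroup G \<lhd> G" "nilpotent_group (G\<lparr>carrier := fitting_subgroup G\<rparr>)"
    "N \<lhd> G \<Longrightarrow> nilpotent_group (G\<lparr>carrier := N\<rparr>) \<Longrightarrow> N \<subseteq> fitting_subgroup G"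
    using M greatest unfolding P_def by auto
qed

end

section \<open>Images of lower central series and normal subgroups\<close>

lemma (in group_hom) lower_central_image:
  assumes T: "subgroup T G"
  shows "lower_central (H\<lparr>carrier := h ` T\<rparr>) i = h ` lower_central (G\<lparr>carrier := T\<rparr>) i"
proof (induction i)
  case (Suc i)
  let ?L = "lower_central (G\<lparr>carrier := T\<rparr>) i"
  let ?C = "{commutator G a b | a b. a \<in> ?L \<and> b \<in> T}"
  have carr: "a \<in> carrier G" if "a \<in> ?L \<or> a \<in> T" for a
    using that G.lower_central_subset[OF T, of i] subgroup.mem_carrier[OF T] by blast
  have "{commutator H a b | a b. a \<in> h ` ?L \<and> b \<in> h ` T} = h ` ?C"
    using carr hom_commutator by (auto simp: image_iff) metis+
  moreover have "?C \<subseteq> carrier G" using carr by auto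
  ultimately show ?case
    unfolding lower_central_restrict_Suc[OF subgroup_img_is_subgroup[OF T]]
      G.lower_central_restrict_Suc[OF T] Suc by (simp add: generate_img)
qed simp

lemma (in group_hom) normal_image:
  assumes surj: "h ` carrier G = carrier H" and R: "R \<lhd> G"
  shows "h ` R \<lhd> H"
proof (rule normal_invI)
  show "subgroup (h ` R) H"
    by (rule subgroup_img_is_subgroup[OF normal_imp_subgroup[OF R]])
next
  fix y r assume "y \<in> carrier H" "r \<in> h ` R"
  then obtain x s where x: "x \<in> carrier G" "y = h x" and s: "s \<in> R" "r = h s"
    using surj by blast
  then have "y \<otimes>\<^bsub>H\<^esub> r \<otimes>\<^bsub>H\<^esub> inv\<^bsub>H\<^esub> y = h (x \<otimes>\<^bsub>G\<^esub> s \<otimes>\<^bsub>G\<^esub> inv\<^bsub>G\<^esub> x)"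
    using subgroup.mem_carrier[OF normal_imp_subgroup[OF R]] by simp
  then show "y \<otimes>\<^bsub>H\<^esub> r \<otimes>\<^bsub>H\<^esub> inv\<^bsub>H\<^esub> y \<in> h ` R"
    using normal.inv_op_closed2[OF R x(1) s(1)] by simp
qed

section \<open>The Fitting series\<close>

text \<open>Replaces the quotient in the definition: the next term is the largest normal subgroup of
  \<open>G\<close> having some lower central term inside the current one. Taking images in the
  quotient by the current term turns this containment into nilpotency. Normality of the current term
  is assumed here because it is supplied by the induction in
  \<open>fitting_series_normal\<close>.\<close>

lemma (in group) fitting_series_Suc_if_normal:
  assumes fin: "finite (carrier G)" and F: "fitting_series G i \<lhd> G"
  shows fitting_series_Suc_normal: "fitting_series G (Suc i) \<lhd> G"
    and lower_central_fitting_series_Suc: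
      "\<exists>c. lower_central (G\<lparr>carrier := fitting_series G (Suc i)\<rparr>) c \<subseteq> fitting_series G i"
    and fitting_series_Suc_greatest:
      "R \<lhd> G \<Longrightarrow> lower_central (G\<lparr>carrier := R\<rparr>) c \<subseteq> fitting_series G i \<Longrightarrow>
        R \<subseteq> fitting_series G (Suc i)"
proof -
  define V where "V = fitting_series G i"
  define Q where "Q = G Mod V"
  have V: "V \<lhd> G" unfolding V_def by (rule F)
  have V': "subgroup V G" by (rule normal_imp_subgroup[OF V])
  have coset_one: "V #> x = V \<longleftrightarrow> x \<in> V" if "x \<in> carrier G" for x
    using coset_eq_iff[OF V' that one_closed] that by (simp add: subgroup.subset[OF V'])
  have "group Q" unfolding Q_def by (rule normal.factorgroup_is_group[OF V])
  moreover have "(\<lambda>x. V #> x) \<in> hom G Q"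
    unfolding Q_def by (rule normal.r_coset_hom_Mod[OF V])
  ultimately interpret \<pi>: group_hom G Q "\<lambda>x. V #> x"
    by (simp add: group_hom_def group_hom_axioms_def)
  have surj: "(\<lambda>x. V #> x) ` carrier G = carrier Q"
    unfolding Q_def by (auto simp: FactGroup_def RCOSETS_def)
  have one_Q: "\<one>\<^bsub>Q\<^esub> = V" unfolding Q_def by simp
  have fin_Q: "finite (carrier Q)"
    using fin unfolding surj[symmetric] by simp
  define \<Phi> where "\<Phi> = fitting_subgroup Q"
  have \<Phi>: "\<Phi> \<lhd> Q" unfolding \<Phi>_def by (rule \<pi>.fitting_subgroup_normal[OF fin_Q])
  have \<Phi>': "subgroup \<Phi> Q" by (rule normal_imp_subgroup[OF \<Phi>])
  define F' where "F' = fitting_series G (Suc i)"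
  have F'_eq: "F' = {x \<in> carrier G. V #> x \<in> \<Phi>}"
    unfolding F'_def V_def \<Phi>_def Q_def by simp
  have F'_sub: "subgroup F' G"
  proof (rule subgroupI)
    show "F' \<noteq> {}"
      using subgroup.one_closed[OF \<Phi>'] \<pi>.hom_one unfolding F'_eq by auto
  qed (auto simp: F'_eq subgroup.m_closed[OF \<Phi>'] subgroup.m_inv_closed[OF \<Phi>'])
  have F': "F' \<lhd> G"
  proof (rule normal_invI[OF F'_sub])
    fix x h assume "x \<in> carrier G" "h \<in> F'"
    then show "x \<otimes> h \<otimes> inv x \<in> F'"
      using normal.inv_op_closed2[OF \<Phi>, of "V #> x" "V #> h"] unfolding F'_eq by simp
  qed
  then show "fitting_series G (Suc i) \<lhd> G" unfolding F'_def .

  have img: "(\<lambda>x. V #> x) ` F' = \<Phi>"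
  proof
    show "\<Phi> \<subseteq> (\<lambda>x. V #> x) ` F'"
    proof
      fix y assume y: "y \<in> \<Phi>"
      then have "y \<in> (\<lambda>x. V #> x) ` carrier G"
        using subgroup.mem_carrier[OF \<Phi>'] surj by simp
      then show "y \<in> (\<lambda>x. V #> x) ` F'"
        using y unfolding F'_eq by auto
    qed
  qed (auto simp: F'_eq)
  obtain d where "lower_central (Q\<lparr>carrier := \<Phi>\<rparr>) d = {V}"
    using \<pi>.fitting_subgroup_nilpotent[OF fin_Q]
    unfolding \<Phi>_def nilpotent_group_def by (auto simp: one_Q)
  then have d: "(\<lambda>x. V #> x) ` lower_central (G\<lparr>carrier := F'\<rparr>) d = {V}"
    using \<pi>.lower_central_image[OF F'_sub] img by simp
  have "lower_central (G\<lparr>carrier := F'\<rparr>) d \<subseteq> V"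
  proof
    fix x assume x: "x \<in> lower_central (G\<lparr>carrier := F'\<rparr>) d"
    then have "V #> x = V" using d by blast
    then show "x \<in> V"
      using coset_one subgroup.mem_carrier[OF lower_central_is_subgroup[OF F'_sub] x] by blast
  qed
  then show "\<exists>c. lower_central (G\<lparr>carrier := fitting_series G (Suc i)\<rparr>) c \<subseteq> fitting_series G i"
    unfolding F'_def V_def by blast

  assume R: "R \<lhd> G" and cR: "lower_central (G\<lparr>carrier := R\<rparr>) c \<subseteq> fitting_series G i"
  have R': "subgroup R G" by (rule normal_imp_subgroup[OF R])
  have R_img: "(\<lambda>x. V #> x) ` R \<lhd> Q"
    by (rule \<pi>.normal_image[OF surj R])
  have "(\<lambda>x. V #> x) ` lower_central (G\<lparr>carrier := R\<rparr>) c = {V}"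
  proof -
    let ?L = "lower_central (G\<lparr>carrier := R\<rparr>) c"
    have L: "subgroup ?L G" by (rule lower_central_is_subgroup[OF R'])
    have "V #> x = V" if "x \<in> ?L" for x
      using that cR coset_one[OF subgroup.mem_carrier[OF L that]] unfolding V_def by blast
    then show ?thesis using subgroup.one_closed[OF L] by auto
  qed
  then have "lower_central (Q\<lparr>carrier := (\<lambda>x. V #> x) ` R\<rparr>) c = {V}"
    unfolding \<pi>.lower_central_image[OF R'] .
  then have "nilpotent_group (Q\<lparr>carrier := (\<lambda>x. V #> x) ` R\<rparr>)"
    unfolding nilpotent_group_def
    using \<pi>.subgroup_imp_group[OF normal_imp_subgroup[OF R_img]] by (auto simp: one_Q)
  then have "(\<lambda>x. V #> x) ` R \<subseteq> \<Phi>"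
    unfolding \<Phi>_def by (rule \<pi>.fitting_subgroup_greatest[OF fin_Q R_img])
  then show "R \<subseteq> fitting_series G (Suc i)"
    using subgroup.subset[OF R'] unfolding F'_def[symmetric] F'_eq by auto
qed

context group
begin

lemma fitting_series_normal:
  assumes "finite (carrier G)"
  shows "fitting_series G i \<lhd> G"
  by (induction i)
    (use one_is_normal fitting_series_Suc_normal[OF assms] in \<open>simp_all del: fitting_series.simps(2)\<close>)

lemmas fitting_series_Suc_lower_central = lower_central_fitting_series_Suc[OF _ fitting_series_normal]
  and fitting_series_Suc_maximal = fitting_series_Suc_greatest[OF _ fitting_series_normal]

end

text \<open>
  Unlike the Fitting series, lower central series are inherited by subgroups and are insensitive to
  restricting the ambient group, which makes this form of ``Fitting height at most \<open>k\<close>'' monotone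
  without any appeal to quotients.
\<close>

primrec fitting_length_le :: "('a, 'b) monoid_scheme \<Rightarrow> nat \<Rightarrow> 'a set \<Rightarrow> bool" where
  "fitting_length_le G 0 T \<longleftrightarrow> T = {\<one>\<^bsub>G\<^esub>}"
| "fitting_length_le G (Suc k) T \<longleftrightarrow>
     (\<exists>c. fitting_length_le G k (lower_central (G\<lparr>carrier := T\<rparr>) c))"

lemma fitting_length_le_restrict [simp]:
  "fitting_length_le (G\<lparr>carrier := E\<rparr>) k T \<longleftrightarrow> fitting_length_le G k T"
  by (induction k arbitrary: T) simp_all

context group
begin

lemma fitting_length_le_mono:
  assumes "fitting_length_le G k T" "subgroup S G" "subgroup T G" "S \<subseteq> T"
  shows "fitting_length_le G k S"
  using assms
proof (induction k arbitrary: S T)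
  case 0
  then show ?case using subgroup.one_closed by fastforce
next
  case (Suc k)
  then obtain c where "fitting_length_le G k (lower_central (G\<lparr>carrier := T\<rparr>) c)" by auto
  then have "fitting_length_le G k (lower_central (G\<lparr>carrier := S\<rparr>) c)"
    using Suc.IH lower_central_mono[OF Suc.prems(2-4)] lower_central_is_subgroup Suc.prems(2,3)
    by blast
  then show ?case by auto
qed

text \<open>The lower central term witnessing the bound is again normal in \<open>G\<close>, so by
  induction it lies in \<open>fitting_series G k\<close>; maximality of the next term then captures
  \<open>T\<close>.\<close>

lemma normal_subset_fitting_series:
  assumes fin: "finite (carrier G)" and "fitting_length_le G k T" "T \<lhd> G"
  shows "T \<subseteq> fitting_series G k"
  using assms(2,3)
proof (induction k arbitrary: T)
  case (Suc k)
  then obtain c where "fitting_length_le G k (lower_central (G\<lparr>carrier := T\<rparr>) c)" by auto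
  then have "lower_central (G\<lparr>carrier := T\<rparr>) c \<subseteq> fitting_series G k"
    by (rule Suc.IH) (rule lower_central_normal[OF Suc.prems(2)])
  then show ?case
    by (rule fitting_series_Suc_maximal[OF fin fin Suc.prems(2)])
qed simp

lemma fitting_length_le_fitting_series:
  assumes fin: "finite (carrier G)"
  shows "fitting_length_le G k (fitting_series G k)"
proof (induction k)
  case (Suc k)
  have sub: "subgroup (fitting_series G i) G" for i
    by (rule normal_imp_subgroup[OF fitting_series_normal[OF fin]])
  obtain c where "lower_central (G\<lparr>carrier := fitting_series G (Suc k)\<rparr>) c \<subseteq> fitting_series G k"
    using fitting_series_Suc_lower_central[OF fin fin] by blast
  then have "fitting_length_le G k (lower_central (G\<lparr>carrier := fitting_series G (Suc k)\<rparr>) c)"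
    by (rule fitting_length_le_mono[OF Suc lower_central_is_subgroup[OF sub] sub])
  then show ?case
    unfolding fitting_length_le.simps by (rule exI)
qed simp

text \<open>The second lower central term lies in the derived subgroup, so each derived step counts
  as one nilpotent step. This ensures that the Fitting series of a finite solvable group reaches the
  whole group.\<close>

lemma fitting_length_le_derived_length:
  assumes "(derived G ^^ n) T = {\<one>}" "subgroup T G"
  shows "fitting_length_le G n T"
  using assms
proof (induction n arbitrary: T)
  case (Suc n)
  have D: "subgroup (derived G T) G"
    by (rule derived_is_subgroup[OF subgroup.subset[OF Suc.prems(2)]])
  have "lower_central (G\<lparr>carrier := T\<rparr>) (Suc 0) \<subseteq> derived G T"
    unfolding lower_central_restrict_Suc[OF Suc.prems(2)]
    by (rule generate_subgroup_incl[OF _ D]) (use commutator_mem_derived[OF Suc.prems(2)] in auto)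
  moreover have "fitting_length_le G n (derived G T)"
    using Suc D by (simp add: funpow_swap1)
  ultimately have "fitting_length_le G n (lower_central (G\<lparr>carrier := T\<rparr>) (Suc 0))"
    using fitting_length_le_mono lower_central_is_subgroup[OF Suc.prems(2)] D by blast
  then show ?case
    unfolding fitting_length_le.simps by (rule exI)
qed simp

text \<open>Solvability makes the \<open>LEAST\<close> in \<open>fitting_height\<close> attained.
  The bound is obtained inside \<open>E\<close> and then read in \<open>G\<close>, where lower
  central series are the same.\<close>

lemma fitting_length_le_fitting_height:
  assumes fin: "finite (carrier G)" and sol: "solvable G" and E: "subgroup E G"
  shows "fitting_length_le G (fitting_height (G\<lparr>carrier := E\<rparr>)) E"
proof -
  interpret E: group "G\<lparr>carrier := E\<rparr>" by (rule subgroup_imp_group[OF E])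
  have fin_E: "finite (carrier (G\<lparr>carrier := E\<rparr>))"
    using fin subgroup.subset[OF E] by (simp add: finite_subset)
  obtain n where "(derived G ^^ n) E = {\<one>}"
    using solvable_imp_trivial_derived_seq[OF solvable_subgroup[OF E sol]] by blast
  then have "fitting_length_le (G\<lparr>carrier := E\<rparr>) n (carrier (G\<lparr>carrier := E\<rparr>))"
    using fitting_length_le_derived_length[OF _ E] by simp
  then have "carrier (G\<lparr>carrier := E\<rparr>) \<subseteq> fitting_series (G\<lparr>carrier := E\<rparr>) n"
    by (rule E.normal_subset_fitting_series[OF fin_E _ E.normal_self])
  then have "fitting_series (G\<lparr>carrier := E\<rparr>) n = carrier (G\<lparr>carrier := E\<rparr>)"
    using subgroup.subset[OF normal_imp_subgroup[OF E.fitting_series_normal[OF fin_E]]] by blast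
  then have "fitting_series (G\<lparr>carrier := E\<rparr>) (fitting_height (G\<lparr>carrier := E\<rparr>)) =
      carrier (G\<lparr>carrier := E\<rparr>)"
    unfolding fitting_height_def by (rule LeastI)
  then show ?thesis
    using E.fitting_length_le_fitting_series[OF fin_E, of "fitting_height (G\<lparr>carrier := E\<rparr>)"] by simp
qed

end

section \<open>Fitting series of normal subgroups\<close>

text \<open>The image of the next term is normal by surjectivity, and one of its lower central terms
  lies in the image of the current term; maximality concludes. Applied to conjugations, which
  restrict to automorphisms of a normal subgroup.\<close>

lemma fitting_series_endomorphism:
  assumes h: "group_hom G G h" and fin: "finite (carrier G)" and surj: "h ` carrier G = carrier G"
  shows "h ` fitting_series G i \<subseteq> fitting_series G i"
proof (induction i)
  case 0
  then show ?case using group_hom.hom_one[OF h] by simp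
next
  case (Suc i)
  interpret group_hom G G h by (fact h)
  let ?F = "fitting_series G (Suc i)"
  have F: "?F \<lhd> G" by (rule G.fitting_series_normal[OF fin])
  have hF: "h ` ?F \<lhd> G"
    by (rule normal_image[OF surj F])
  obtain c where c: "lower_central (G\<lparr>carrier := ?F\<rparr>) c \<subseteq> fitting_series G i"
    using G.fitting_series_Suc_lower_central[OF fin fin] by blast
  have "lower_central (G\<lparr>carrier := h ` ?F\<rparr>) c = h ` lower_central (G\<lparr>carrier := ?F\<rparr>) c"
    by (rule lower_central_image[OF normal_imp_subgroup[OF F]])
  also have "\<dots> \<subseteq> fitting_series G i"
    using c Suc by blast
  finally show ?case
    by (rule G.fitting_series_Suc_maximal[OF fin fin hF])
qed

context group
begin

lemma fitting_series_of_normal: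
  assumes fin: "finite (carrier G)" and H: "H \<lhd> G"
  shows "fitting_series (G\<lparr>carrier := H\<rparr>) i \<lhd> G"
proof -
  have H': "subgroup H G" by (rule normal_imp_subgroup[OF H])
  interpret H: group "G\<lparr>carrier := H\<rparr>" by (rule subgroup_imp_group[OF H'])
  have fin_H: "finite (carrier (G\<lparr>carrier := H\<rparr>))"
    using fin subgroup.subset[OF H'] by (simp add: finite_subset)
  let ?F = "fitting_series (G\<lparr>carrier := H\<rparr>) i"
  show ?thesis
  proof (rule normal_invI)
    show "subgroup ?F G"
      by (rule incl_subgroup[OF H' normal_imp_subgroup[OF H.fitting_series_normal[OF fin_H]]])
  next
    fix x y assume x: "x \<in> carrier G" and y: "y \<in> ?F"
    \<comment> \<open>Conjugation z -> x z x^-1, written with \<open>inv (inv x)\<close> to match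
      \<open>group_hom_conj\<close> for the element \<open>inv x\<close>.\<close>
    define \<phi> where "\<phi> z = inv (inv x) \<otimes> z \<otimes> inv x" for z
    interpret \<phi>: group_hom "G\<lparr>carrier := H\<rparr>" "G\<lparr>carrier := H\<rparr>" \<phi>
      unfolding \<phi>_def by (rule group_hom_conj[OF inv_closed[OF x] H])
    have "\<phi> ` H = H"
    proof
      show "\<phi> ` H \<subseteq> H" using \<phi>.hom_closed by auto
      show "H \<subseteq> \<phi> ` H"
      proof
        fix z assume z: "z \<in> H"
        have "z = \<phi> (inv x \<otimes> z \<otimes> x)"
          using x subgroup.mem_carrier[OF H' z]
          unfolding \<phi>_def by (simp add: m_assoc mult_inv_cancel_left)
        then show "z \<in> \<phi> ` H"
          using normal.inv_op_closed1[OF H x z] by blast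
      qed
    qed
    then have "\<phi> ` ?F \<subseteq> ?F"
      by (intro fitting_series_endomorphism[OF \<phi>.group_hom_axioms fin_H]) simp
    then show "x \<otimes> y \<otimes> inv x \<in> ?F"
      using y x unfolding \<phi>_def by auto
  qed
qed

section \<open>Engel subgroups and the reduction to the normal closure of \<open>g\<close>\<close>

lemma engel_subgroup_is_subgroup:
  "g \<in> carrier G \<Longrightarrow> subgroup (engel_subgroup G n g) G"
  unfolding engel_subgroup_def
  by (rule generate_is_subgroup) (auto simp: left_normed_commutator_closed)

lemma engel_subgroup_restrict_subset:
  assumes H: "subgroup H G" and g: "g \<in> H"
  shows "engel_subgroup (G\<lparr>carrier := H\<rparr>) n g \<subseteq> engel_subgroup G n g"
proof -
  interpret H: group "G\<lparr>carrier := H\<rparr>" by (rule subgroup_imp_group[OF H])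
  let ?T = "{left_normed_commutator (G\<lparr>carrier := H\<rparr>) x (replicate n g) | x. x \<in> H}"
  have "?T \<subseteq> H"
    using H.left_normed_commutator_closed g by auto
  then have "engel_subgroup (G\<lparr>carrier := H\<rparr>) n g = generate G ?T"
    unfolding engel_subgroup_def using generate_consistent[OF _ H] by simp
  also have "\<dots> \<subseteq> engel_subgroup G n g"
    unfolding engel_subgroup_def
    by (rule mono_generate)
      (use left_normed_commutator_consistent[OF H _ g] subgroup.mem_carrier[OF H] in auto)
  finally show ?thesis .
qed

lemma solvable_restrict:
  assumes "solvable G" and H: "subgroup H G"
  shows "solvable (G\<lparr>carrier := H\<rparr>)"
proof -
  interpret i: group_hom "G\<lparr>carrier := H\<rparr>" G id
    using subgroup_imp_group[OF H] subgroup.subset[OF H]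
    by (auto simp: group_hom_def group_hom_axioms_def hom_def group_axioms)
  show ?thesis
    by (rule i.inj_hom_imp_solvable) (use assms in auto)
qed

text \<open>The subgroup \<open>N\<close> generated by all [x, g] is normal because y [x, g] y^-1 =
  [x y^-1, g] [y^-1, g]^-1. Modulo \<open>N\<close> the element \<open>g\<close> is central, hence
  so are its conjugates; as they generate \<open>G\<close>, the quotient is abelian. Working with
  \<open>N\<close> avoids assuming that \<open>E\<close> is normal.\<close>

lemma commutator_mem_if_generated_by_conjugates:
  assumes g: "g \<in> carrier G"
    and gen: "generate G ((\<lambda>x. inv x \<otimes> g \<otimes> x) ` carrier G) = carrier G"
    and E: "subgroup E G" "\<And>x. x \<in> carrier G \<Longrightarrow> commutator G x g \<in> E"
    and ab: "a \<in> carrier G" "b \<in> carrier G"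
  shows "commutator G a b \<in> E"
proof -
  define S where "S = (\<lambda>x. commutator G x g) ` carrier G"
  define N where "N = generate G S"
  have S: "S \<subseteq> carrier G" unfolding S_def using g by auto
  have N_sub: "subgroup N G" unfolding N_def by (rule generate_is_subgroup[OF S])
  have S_N: "commutator G x g \<in> N" if "x \<in> carrier G" for x
    unfolding N_def S_def using that by (intro generate.incl) simp
  have N: "N \<lhd> G"
  proof (rule normal_invI[OF N_sub])
    fix y z assume y: "y \<in> carrier G" and z: "z \<in> N"
    have "inv (inv y) \<otimes> z \<otimes> inv y \<in> N"
    proof (rule conj_generate_mem[OF S inv_closed[OF y] N_sub _ z[unfolded N_def]])
      fix s assume "s \<in> S"
      then obtain x where x: "x \<in> carrier G" and s: "s = commutator G x g"
        unfolding S_def by blast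
      have "inv (inv y) \<otimes> s \<otimes> inv y = commutator G (x \<otimes> inv y) g \<otimes> inv (commutator G (inv y) g)"
        unfolding s using x y g
        by (simp add: commutator_def inv_mult_group m_assoc mult_inv_cancel_left)
      then show "inv (inv y) \<otimes> s \<otimes> inv y \<in> N"
        using S_N x y by (simp add: subgroup.m_closed[OF N_sub] subgroup.m_inv_closed[OF N_sub])
    qed
    then show "y \<otimes> z \<otimes> inv y \<in> N" using y by simp
  qed
  have "commutator G a b \<in> N"
  proof (rule commutator_mem_generate_right[OF N])
    show "b \<in> generate G ((\<lambda>x. inv x \<otimes> g \<otimes> x) ` carrier G)" using gen ab by simp
  next
    fix s assume "s \<in> (\<lambda>x. inv x \<otimes> g \<otimes> x) ` carrier G"
    then obtain w where w: "w \<in> carrier G" and s: "s = inv w \<otimes> g \<otimes> w" by blast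
    show "commutator G a s \<in> N"
      unfolding s by (rule conj_commutator_mem_right[OF N ab(1) g w]) (use S_N ab w in simp)
  qed (use g ab in auto)
  moreover have "N \<subseteq> E"
    unfolding N_def S_def by (rule generate_subgroup_incl[OF _ E(1)]) (use E in auto)
  ultimately show ?thesis by blast
qed

lemma mem_fitting_series_if_generated_by_conjugates:
  assumes fin: "finite (carrier G)" and sol: "solvable G" and g: "g \<in> carrier G"
    and gen: "generate G ((\<lambda>x. inv x \<otimes> g \<otimes> x) ` carrier G) = carrier G"
    and E: "fitting_length_le G k (engel_subgroup G n g)"
  shows "g \<in> fitting_series G (Suc k)"
proof -
  have E_sub: "subgroup (engel_subgroup G n g) G"
    by (rule engel_subgroup_is_subgroup[OF g])
  \<comment> \<open>Index \<open>Suc 0\<close> is the commutator subgroup of \<open>G\<close>. Once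
    it lies in the Engel subgroup, \<open>G\<close> costs one nilpotent step more.\<close>
  let ?L = "lower_central (G\<lparr>carrier := carrier G\<rparr>) (Suc 0)"
  have "?L \<subseteq> engel_subgroup G n g"
    unfolding lower_central_restrict_Suc[OF subgroup_self]
  proof (rule generate_subgroup_incl[OF _ E_sub])
    show "{commutator G a b | a b. a \<in> lower_central (G\<lparr>carrier := carrier G\<rparr>) 0 \<and> b \<in> carrier G}
        \<subseteq> engel_subgroup G n g"
      using commutator_mem_if_generated_by_conjugates[OF g gen E_sub
          commutator_mem_engel_subgroup[OF fin sol g gen]] by auto
  qed
  then have "fitting_length_le G k ?L"
    by (rule fitting_length_le_mono[OF E lower_central_is_subgroup[OF subgroup_self] E_sub])
  then have "fitting_length_le G (Suc k) (carrier G)"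
    unfolding fitting_length_le.simps by (rule exI)
  then show ?thesis
    using normal_subset_fitting_series[OF fin _ normal_self] g by blast
qed

end

text \<open>The conjugates of \<open>g\<close> under its normal closure \<open>H\<close> may
  generate a proper subgroup of \<open>H\<close>, so a single passage to \<open>H\<close> may not
  reach the generated case. Hence the induction on the order of \<open>G\<close>.\<close>

lemma mem_fitting_series_if_engel_subgroup:
  assumes "group G" "finite (carrier G)" "solvable G" "g \<in> carrier G"
    and "fitting_length_le G k (engel_subgroup G n g)"
  shows "g \<in> fitting_series G (Suc k)"
  using assms
proof (induction "card (carrier G)" arbitrary: G rule: less_induct)
  case less
  interpret group G by (fact less.prems(1))
  note fin = less.prems(2) and sol = less.prems(3) and g = less.prems(4)
  let ?S = "(\<lambda>x. inv\<^bsub>G\<^esub> x \<otimes>\<^bsub>G\<^esub> g \<otimes>\<^bsub>G\<^esub> x) ` carrier G"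
  define H where "H = generate G ?S"
  have S: "?S \<subseteq> carrier G" using g by auto
  have H': "subgroup H G" unfolding H_def by (rule generate_is_subgroup[OF S])
  have "\<one>\<^bsub>G\<^esub> \<in> carrier G" "g = inv\<^bsub>G\<^esub> \<one>\<^bsub>G\<^esub> \<otimes>\<^bsub>G\<^esub> g \<otimes>\<^bsub>G\<^esub> \<one>\<^bsub>G\<^esub>" using g by simp_all
  then have gH: "g \<in> H" unfolding H_def by (intro generate.incl image_eqI)
  show ?case
  proof (cases "H = carrier G")
    case True
    then show ?thesis
      using mem_fitting_series_if_generated_by_conjugates[OF fin sol g _ less.prems(5)]
      unfolding H_def by blast
  next
    case False
    have H: "H \<lhd> G"
      unfolding H_def
    proof (rule normal_generateI[OF S])
      fix h y assume "h \<in> ?S" and y: "y \<in> carrier G"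
      then obtain x where x: "x \<in> carrier G" and h: "h = inv\<^bsub>G\<^esub> x \<otimes>\<^bsub>G\<^esub> g \<otimes>\<^bsub>G\<^esub> x" by blast
      have "y \<otimes>\<^bsub>G\<^esub> h \<otimes>\<^bsub>G\<^esub> inv\<^bsub>G\<^esub> y =
          inv\<^bsub>G\<^esub> (x \<otimes>\<^bsub>G\<^esub> inv\<^bsub>G\<^esub> y) \<otimes>\<^bsub>G\<^esub> g \<otimes>\<^bsub>G\<^esub> (x \<otimes>\<^bsub>G\<^esub> inv\<^bsub>G\<^esub> y)"
        unfolding h using x y g by (simp add: inv_mult_group m_assoc)
      then show "y \<otimes>\<^bsub>G\<^esub> h \<otimes>\<^bsub>G\<^esub> inv\<^bsub>G\<^esub> y \<in> ?S"
        using x y by (intro image_eqI[where x = "x \<otimes>\<^bsub>G\<^esub> inv\<^bsub>G\<^esub> y"]) auto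
    qed
    let ?H = "G\<lparr>carrier := H\<rparr>"
    interpret H: group ?H by (rule subgroup_imp_group[OF H'])
    have fin_H: "finite (carrier ?H)"
      using fin subgroup.subset[OF H'] by (simp add: finite_subset)
    have "subgroup (engel_subgroup ?H n g) G"
      by (rule incl_subgroup[OF H' H.engel_subgroup_is_subgroup]) (use gH in simp)
    then have "fitting_length_le G k (engel_subgroup ?H n g)"
      using fitting_length_le_mono[OF less.prems(5) _ engel_subgroup_is_subgroup[OF g]]
        engel_subgroup_restrict_subset[OF H' gH] by blast
    moreover have "card (carrier ?H) < card (carrier G)"
      using False subgroup.subset[OF H'] fin by (simp add: psubset_card_mono psubsetI)
    ultimately have "g \<in> fitting_series ?H (Suc k)"
      using less.hyps[of ?H] fin_H H.group_axioms solvable_restrict[OF sol H'] gH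
      by (simp del: fitting_series.simps)
    \<comment> \<open>This term is normal in \<open>G\<close> because conjugations act on
      \<open>H\<close> as automorphisms, and its length bound is the same in \<open>H\<close> and in
      \<open>G\<close>.\<close>
    moreover have "fitting_series ?H (Suc k) \<subseteq> fitting_series G (Suc k)"
    proof (rule normal_subset_fitting_series[OF fin _ fitting_series_of_normal[OF fin H]])
      show "fitting_length_le G (Suc k) (fitting_series ?H (Suc k))"
        using H.fitting_length_le_fitting_series[OF fin_H, of "Suc k"]
        unfolding fitting_length_le_restrict .
    qed
    ultimately show ?thesis by blast
  qed
qed

theorem theorem1p1:
  fixes G :: "('a, 'b) monoid_scheme" and g :: 'a and n k :: nat
  assumes "group G" and "finite (carrier G)" and "solvable G"
    and "g \<in> carrier G" and "n \<ge> 1"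
    and "fitting_height (G\<lparr>carrier := engel_subgroup G n g\<rparr>) = k"
  shows "g \<in> fitting_series G (k + 1)"
proof -
  interpret group G by (fact assms(1))
  have "fitting_length_le G k (engel_subgroup G n g)"
    unfolding assms(6)[symmetric]
    by (rule fitting_length_le_fitting_height[OF assms(2,3) engel_subgroup_is_subgroup[OF assms(4)]])
  then show ?thesis
    using mem_fitting_series_if_engel_subgroup[OF assms(1-4)] by (simp del: fitting_series.simps)
qed

end
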